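(* Let $P_1\subset\mathbb{R}^{d_1}$ and $P_2\subset\mathbb{R}^{d_2}$ be full-dimensional convex polytopes such that $P_1$ has more vertices than facets, $f_0(P_1)>f_{d_1-1}(P_1)$, and $P_2$ has fewer vertices than facets, $f_0(P_2)<f_{d_2-1}(P_2)$. Then the free join $P_1\bowtie P_2$ does not have a vertex-facet assignment.
   Context: The free join $P_1\bowtie P_2\subset\mathbb{R}^{d_1+d_2+1}$ is the convex hull of copies $\bar P_1,\bar P_2$ of $P_1$ and $P_2$ placed in skew affine subspaces of $\mathbb{R}^{d_1+d_2+1}$ (affine subspaces of dimensions $d_1$ and $d_2$ which are disjoint and not parallel in any direction, so that their affine hull is all of $\mathbb{R}^{d_1+d_2+1}$); it is a $(d_1+d_2+1)$-dimensional polytope. $f_0(Q)$ denotes the number of vertices and $f_{e-1}(Q)$ the number of facets of an $e$-dimensional polytope $Q$. A vertex-facet assignment of a polytope $P$ is a set $M$ of pairs $(v,F)$ with $v$ a vertex of $P$, $F$ a facet of $P$, and $v\notin F$, such that each vertex and each facet occurs in at most one pair of $M$, and such that either every vertex of $P$ occurs in some pair of $M$ or every facet of $P$ occurs in some pair of $M$ (or both). *)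

theory Defs
  imports "HOL-Analysis.Analysis"
begin

definition affine_copy :: "'a::euclidean_space set \<Rightarrow> 'c::euclidean_space set \<Rightarrow> bool" where
  "affine_copy P P' \<longleftrightarrow> (\<exists>L c. linear L \<and> inj L \<and> P' = (\<lambda>x. c + L x) ` P)"

text \<open>The last conjunct says that the direction spaces of the two (nonempty) affine subspaces
  meet only in the zero vector, i.e. the subspaces have no common direction.\<close>

definition skew :: "'c::euclidean_space set \<Rightarrow> 'c set \<Rightarrow> bool" where
  "skew A B \<longleftrightarrow> affine A \<and> affine B \<and> A \<inter> B = {} \<and>
     {x - y | x y. x \<in> A \<and> y \<in> A} \<inter> {x - y | x y. x \<in> B \<and> y \<in> B} = {0}"

text \<open>The free join is determined only up to the choice of the two copies, hence it is a
  relation: any \<open>Q\<close> obtained from some admissible placement is a free join of \<open>P1\<close> and \<open>P2\<close>.\<close>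

definition is_free_join ::
  "'a::euclidean_space set \<Rightarrow> 'b::euclidean_space set \<Rightarrow> 'c::euclidean_space set \<Rightarrow> bool" where
  "is_free_join P1 P2 Q \<longleftrightarrow>
     DIM('c) = DIM('a) + DIM('b) + 1 \<and>
     (\<exists>A1 A2 P1' P2'.
        skew A1 A2 \<and> aff_dim A1 = int (DIM('a)) \<and> aff_dim A2 = int (DIM('b)) \<and>
        affine_copy P1 P1' \<and> P1' \<subseteq> A1 \<and>
        affine_copy P2 P2' \<and> P2' \<subseteq> A2 \<and>
        Q = convex hull (P1' \<union> P2'))"

definition vertex_facet_assignment :: "'a::euclidean_space set \<Rightarrow> ('a \<times> 'a set) set \<Rightarrow> bool" where
  "vertex_facet_assignment P M \<longleftrightarrow>
     (\<forall>(v, F) \<in> M. v extreme_point_of P \<and> F facet_of P \<and> v \<notin> F) \<and>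
     (\<forall>v F F'. (v, F) \<in> M \<and> (v, F') \<in> M \<longrightarrow> F = F') \<and>
     (\<forall>v v' F. (v, F) \<in> M \<and> (v', F) \<in> M \<longrightarrow> v = v') \<and>
     ((\<forall>v. v extreme_point_of P \<longrightarrow> (\<exists>F. (v, F) \<in> M)) \<or>
      (\<forall>F. F facet_of P \<longrightarrow> (\<exists>v. (v, F) \<in> M)))"

text \<open>Free joins exist: the standard placement in the product space.\<close>

lemma is_free_join_standard:
  fixes P1 :: "'a::euclidean_space set" and P2 :: "'b::euclidean_space set"
  shows "is_free_join P1 P2
    (convex hull ((\<lambda>x. (x, 0, 0)) ` P1 \<union> (\<lambda>y. (0, y, 1)) ` P2) :: ('a \<times> 'b \<times> real) set)"
proof -
  define f :: "'a \<Rightarrow> 'a \<times> 'b \<times> real" where "f = (\<lambda>x. (x, 0, 0))"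
  define L :: "'b \<Rightarrow> 'a \<times> 'b \<times> real" where "L = (\<lambda>y. (0, y, 0))"
  define c :: "'a \<times> 'b \<times> real" where "c = (0, 0, 1)"
  have lf: "linear f" "inj f" and lL: "linear L" "inj L"
    by (auto simp: f_def L_def inj_on_def intro!: linearI)
  have g: "(\<lambda>y. (0, y, 1)) = (\<lambda>y. c + L y)" by (simp add: c_def L_def)
  have rg: "range (\<lambda>y. c + L y) = (+) c ` range L" by auto
  have aff: "affine (range f)" "affine (range (\<lambda>y. c + L y))"
    unfolding rg affine_translation[symmetric] using lf lL
    by (auto intro!: subspace_imp_affine linear_subspace_image)
  have dims: "aff_dim (range f) = int DIM('a)" "aff_dim (range (\<lambda>y. c + L y)) = int DIM('b)"
    unfolding rg using lf lL by (simp_all add: aff_dim_translation_eq aff_dim_injective_linear_image)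
  have sk: "skew (range f) (range (\<lambda>y. c + L y))"
    unfolding skew_def using aff
    by (auto simp: f_def c_def L_def zero_prod_def) blast+
  have c1: "affine_copy P1 (f ` P1)"
    unfolding affine_copy_def using lf by (intro exI[of _ f] exI[of _ 0]) auto
  have c2: "affine_copy P2 ((\<lambda>y. c + L y) ` P2)"
    unfolding affine_copy_def using lL by (intro exI[of _ L] exI[of _ c]) simp
  show ?thesis
    unfolding is_free_join_def g f_def[symmetric]
    using sk dims c1 c2
    by (intro conjI exI[of _ "range f"] exI[of _ "range (\<lambda>y. c + L y)"]
        exI[of _ "f ` P1"] exI[of _ "(\<lambda>y. c + L y) ` P2"]) auto
qed

end

theory Submission
  imports Defs
begin

text \<open>
  Skewness makes affine dimension additive: \<open>aff_dim (S \<union> T) = aff_dim S + aff_dim T + 1\<close> for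
  sets \<open>S\<close>, \<open>T\<close> in the two skew subspaces. A facet \<open>G\<close> of the join is the convex hull of its traces
  on the copies \<open>P\<close> and \<open>R\<close>, so if \<open>G\<close> does not contain \<open>P\<close>, counting dimensions shows that it
  contains \<open>R\<close> and meets \<open>P\<close> in a facet of \<open>P\<close>, which determines \<open>G\<close>. Hence vertices of \<open>P\<close> can only
  be assigned facets \<open>conv (F \<union> R)\<close> coming from facets \<open>F\<close> of \<open>P\<close>, and facets \<open>conv (P \<union> F)\<close> can only
  be assigned vertices of \<open>R\<close>. So an assignment covering all vertices needs at least as many facets
  as vertices in \<open>P\<close>, and one covering all facets needs at least as many vertices as facets in \<open>R\<close>.
\<close>

section \<open>Affine independence and dimension in skew subspaces\<close>

lemma sum_scaleR_in_directions:
  assumes "affine A" "finite S" "S \<subseteq> A" "S \<noteq> {}" "sum U S = 0"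
  shows "(\<Sum>v\<in>S. U v *\<^sub>R v) \<in> {x - y | x y. x \<in> A \<and> y \<in> A}"
proof -
  obtain w where w: "w \<in> S" using assms(4) by blast
  \<comment> \<open>Raising the weight at \<open>w\<close> by one turns the sum into an affine
    combination, hence a point of \<open>A\<close>; its difference from \<open>w\<close> is the
    direction sought.\<close>
  define U' where "U' v = U v + (if v = w then 1 else 0)" for v
  have "sum U' S = 1"
    using assms(2,5) w by (simp add: U'_def sum.distrib)
  then have "(\<Sum>v\<in>S. U' v *\<^sub>R v) \<in> A"
    using assms by (auto simp: affine)
  moreover have "(\<Sum>v\<in>S. U' v *\<^sub>R v) = (\<Sum>v\<in>S. U v *\<^sub>R v) + w"
    using assms(2) w
    by (simp add: U'_def scaleR_add_left sum.distrib if_distrib[where f="\<lambda>c. c *\<^sub>R _"] cong: if_cong)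
  ultimately show ?thesis
    using w assms(3) by force
qed

text \<open>A dependency splits into an \<open>S\<close>-part of total weight \<open>s\<close> and a
  \<open>T\<close>-part of total weight \<open>- s\<close>. If \<open>s\<close> is nonzero,
  normalising both parts yields a common point of \<open>A\<close> and \<open>B\<close>. If
  \<open>s = 0\<close>, the \<open>S\<close>-part is a common direction, hence zero, and then the
  independence of \<open>S\<close> and of \<open>T\<close> kills all weights.\<close>

lemma affine_independent_Un_skew:
  fixes S T :: "'a::euclidean_space set"
  assumes skew: "skew A B" and "S \<subseteq> A" "T \<subseteq> B"
    and indep: "\<not> affine_dependent S" "\<not> affine_dependent T"
  shows "\<not> affine_dependent (S \<union> T)"
proof
  have fin: "finite S" "finite T" using indep aff_independent_finite by auto
  have aff: "affine A" "affine B" and disj: "A \<inter> B = {}"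
    and dir: "{x - y | x y. x \<in> A \<and> y \<in> A} \<inter> {x - y | x y. x \<in> B \<and> y \<in> B} = {0}"
    using skew unfolding skew_def by auto
  have ST: "S \<inter> T = {}" using disj assms by blast
  assume "affine_dependent (S \<union> T)"
  then obtain U where U: "sum U (S \<union> T) = 0" "\<exists>v\<in>S \<union> T. U v \<noteq> 0" "(\<Sum>v\<in>S \<union> T. U v *\<^sub>R v) = 0"
    using affine_dependent_explicit_finite[of "S \<union> T"] fin by auto
  define s x y where "s = sum U S" and "x = (\<Sum>v\<in>S. U v *\<^sub>R v)" and "y = (\<Sum>v\<in>T. U v *\<^sub>R v)"
  have sT: "sum U T = - s" and xy: "y = - x"
    using U fin ST by (auto simp: sum.union_disjoint s_def x_def y_def eq_neg_iff_add_eq_0 add.commute)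
  show False
  proof (cases "s = 0")
    case False
    then have "S \<noteq> {}" "T \<noteq> {}"
      using sT by (auto simp: s_def)
    moreover have "(\<Sum>v\<in>S. U v / s) = 1" "(\<Sum>v\<in>T. U v / - s) = 1"
      using False sT by (simp_all add: s_def[symmetric] sum_divide_distrib[symmetric] sum_negf)
    ultimately have "(\<Sum>v\<in>S. (U v / s) *\<^sub>R v) \<in> A" "(\<Sum>v\<in>T. (U v / - s) *\<^sub>R v) \<in> B"
      using aff fin assms(2,3) unfolding affine by blast+
    moreover have "(\<Sum>v\<in>S. (U v / s) *\<^sub>R v) = (1 / s) *\<^sub>R x"
      by (simp add: x_def scaleR_sum_right)
    moreover have "(\<Sum>v\<in>T. (U v / - s) *\<^sub>R v) = - (1 / s) *\<^sub>R y"
      by (simp add: y_def scaleR_sum_right sum_negf)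
    ultimately show False
      using disj xy by auto
  next
    case True
    have "x = 0"
    proof (cases "S = {} \<or> T = {}")
      case True
      then show ?thesis using xy by (auto simp: x_def y_def)
    next
      case False
      then have "x \<in> {x - y | x y. x \<in> A \<and> y \<in> A}"
        using sum_scaleR_in_directions[of A S U] aff fin assms(2) True by (simp add: x_def s_def)
      moreover have "y \<in> {x - y | x y. x \<in> B \<and> y \<in> B}"
        using sum_scaleR_in_directions[of B T U] aff fin assms(3) True sT False by (simp add: y_def)
      then obtain b b' where "b \<in> B" "b' \<in> B" "x = b' - b"
        using xy by (auto simp: minus_equation_iff[of x])
      then have "x \<in> {x - y | x y. x \<in> B \<and> y \<in> B}" by blast
      ultimately show ?thesis using dir by blast
    qed
    then have "\<forall>v\<in>S. U v = 0"
      using indep(1) True affine_dependent_explicit_finite[OF fin(1)] by (auto simp: s_def x_def)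
    moreover have "\<forall>v\<in>T. U v = 0"
      using indep(2) True sT xy \<open>x = 0\<close> affine_dependent_explicit_finite[OF fin(2)]
      by (auto simp: y_def)
    ultimately show False using U(2) by blast
  qed
qed

text \<open>Affine bases of \<open>S\<close> and \<open>T\<close> unite to a basis of the union; the
  \<open>+ 1\<close> arises because \<open>aff_dim\<close> is one less than the size of a basis.
  Since \<open>aff_dim {} = -1\<close>, the formula also covers traces of a face that may be
  empty.\<close>

lemma aff_dim_Un_skew:
  fixes S T :: "'a::euclidean_space set"
  assumes skew: "skew A B" and "S \<subseteq> A" "T \<subseteq> B"
  shows "aff_dim (S \<union> T) = aff_dim S + aff_dim T + 1"
proof -
  obtain BS where BS: "BS \<subseteq> S" "\<not> affine_dependent BS" "affine hull S = affine hull BS"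
    using affine_basis_exists by blast
  obtain BT where BT: "BT \<subseteq> T" "\<not> affine_dependent BT" "affine hull T = affine hull BT"
    using affine_basis_exists by blast
  have fin: "finite BS" "finite BT" using BS(2) BT(2) by (simp_all add: aff_independent_finite)
  have "BS \<inter> BT = {}" using assms BS BT unfolding skew_def by blast
  then have card: "card (BS \<union> BT) = card BS + card BT" using fin by (simp add: card_Un_disjoint)
  have "\<not> affine_dependent (BS \<union> BT)"
    by (rule affine_independent_Un_skew[OF skew _ _ BS(2) BT(2)]) (use BS(1) BT(1) assms in auto)
  moreover have "affine hull (BS \<union> BT) = affine hull (S \<union> T)"
    using hull_Un_left[of affine S T] hull_Un_right[of affine BS T] BS(3) BT(3)
      hull_Un_left[of affine BS T] hull_Un_right[of affine BS BT] by simp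
  ultimately have "int (card (BS \<union> BT)) = aff_dim (S \<union> T) + 1"
    using aff_dim_unique by blast
  moreover have "int (card BS) = aff_dim S + 1" "int (card BT) = aff_dim T + 1"
    using BS BT aff_dim_unique[of BS S] aff_dim_unique[of BT T] by auto
  ultimately show ?thesis using card by simp
qed

text \<open>Adding such a point \<open>p\<close> does not raise the dimension of
  \<open>S \<union> T\<close>, so by additivity it does not raise that of \<open>T\<close>
  either.\<close>

lemma affine_hull_Un_skew_Int:
  fixes S T :: "'a::euclidean_space set"
  assumes skew: "skew A B" and "S \<subseteq> A" "T \<subseteq> B"
  shows "affine hull (S \<union> T) \<inter> B \<subseteq> affine hull T"
proof
  fix p assume p: "p \<in> affine hull (S \<union> T) \<inter> B"
  then have "aff_dim (S \<union> insert p T) = aff_dim (S \<union> T)"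
    by (simp add: aff_dim_insert)
  then have "aff_dim (insert p T) = aff_dim T"
    using aff_dim_Un_skew[OF skew, of S T] aff_dim_Un_skew[OF skew, of S "insert p T"] p assms by simp
  then show "p \<in> affine hull T"
    by (auto simp: aff_dim_insert split: if_splits)
qed

section \<open>Faces of the join\<close>

lemma convex_Diff_face_of:
  assumes "convex S" "T face_of S"
  shows "convex (S - T)"
  unfolding convex_contains_segment
proof (intro ballI subsetI)
  fix a b x assume ab: "a \<in> S - T" "b \<in> S - T" and x: "x \<in> closed_segment a b"
  then have "x \<in> S" using assms(1) unfolding convex_contains_segment by blast
  \<comment> \<open>A point of \<open>T\<close> inside the open segment would drag both endpoints
    into \<open>T\<close>.\<close>
  moreover have "x \<notin> T"
    using ab x \<open>x \<in> S\<close> assms(2) unfolding face_of_def open_segment_def by blast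
  ultimately show "x \<in> S - T" by blast
qed

text \<open>Recovers \<open>F\<close> from its join with \<open>P\<close>, which later makes the
  passage from facets of \<open>R\<close> to facets of the join injective. It works because
  \<open>F\<close> is the slice of \<open>R\<close> by the affine hull of \<open>F\<close>.\<close>

lemma convex_hull_Un_face_Int:
  fixes P R :: "'a::euclidean_space set"
  assumes skew: "skew A B" "P \<subseteq> A" "R \<subseteq> B" and "convex R" "F face_of R"
  shows "convex hull (P \<union> F) \<inter> R = F"
proof
  have F: "F \<subseteq> R" using assms face_of_imp_subset by blast
  have "convex hull (P \<union> F) \<inter> R \<subseteq> affine hull F \<inter> R"
    using affine_hull_Un_skew_Int[OF skew(1,2), of F] convex_hull_subset_affine_hull[of "P \<union> F"] F skew(3)
    by blast
  then show "convex hull (P \<union> F) \<inter> R \<subseteq> F"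
    using assms(4,5) face_of_imp_eq_affine_Int by blast
  show "F \<subseteq> convex hull (P \<union> F) \<inter> R"
    using F hull_subset[of "P \<union> F" convex] by auto
qed

text \<open>Some of finitely many generators span a face if their affine hull misses the convex hull
  of the other generators. Here the others have their hull in \<open>R - F\<close>, while the affine
  hull of the chosen ones meets \<open>R\<close> only inside \<open>F\<close>.\<close>

lemma convex_hull_Un_face:
  fixes P R :: "'a::euclidean_space set"
  assumes skew: "skew A B" "P \<subseteq> A" "R \<subseteq> B" and poly: "polytope P" "polytope R" and F: "F face_of R"
  shows "convex hull (P \<union> F) face_of convex hull (P \<union> R)"
proof -
  obtain V W where V: "finite V" "P = convex hull V" and W: "finite W" "R = convex hull W"
    using poly unfolding polytope_def by blast
  obtain W' where W': "W' \<subseteq> W" "F = convex hull W'"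
    using face_of_convex_hull_subset F W finite_imp_compact by metis
  define T where "T = V \<union> (W \<inter> F)"
  have "F \<subseteq> R" using F face_of_imp_subset by blast
  \<comment> \<open>The generators \<open>W'\<close> are enlarged to all those in \<open>F\<close>,
    so that the ones left over lie outside \<open>F\<close>.\<close>
  have WF: "F = convex hull (W \<inter> F)"
  proof
    show "F \<subseteq> convex hull (W \<inter> F)"
      using W' hull_mono[of W' "W \<inter> F" convex] hull_subset[of W' convex] by blast
    show "convex hull (W \<inter> F) \<subseteq> F"
      using face_of_imp_convex[OF F] by (simp add: hull_minimal)
  qed
  have VP: "V \<subseteq> A" using V skew(2) hull_subset[of V convex] by blast
  have "convex (R - F)"
    using F poly(2) by (simp add: convex_Diff_face_of polytope_imp_convex)
  then have "convex hull (W - F) \<subseteq> R - F"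
    using W hull_subset[of W convex] by (intro hull_minimal) auto
  moreover have "affine hull T \<inter> R \<subseteq> F"
  proof -
    have "affine hull T \<inter> B \<subseteq> affine hull (W \<inter> F)"
      unfolding T_def using affine_hull_Un_skew_Int[OF skew(1) VP] \<open>F \<subseteq> R\<close> skew(3) by blast
    also have "\<dots> \<subseteq> affine hull F" by (simp add: hull_mono)
    finally show ?thesis
      using face_of_imp_eq_affine_Int[OF polytope_imp_convex[OF poly(2)] F] skew(3) by blast
  qed
  ultimately have "affine hull T \<inter> convex hull (W - F) = {}" by blast
  moreover have "(V \<union> W) - T \<subseteq> W - F" unfolding T_def by blast
  ultimately have "affine hull T \<inter> convex hull ((V \<union> W) - T) = {}"
    using hull_mono[of "(V \<union> W) - T" "W - F" convex] by blast
  then have "convex hull T face_of convex hull (V \<union> W)"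
    using V W by (intro face_of_convex_hulls) (auto simp: T_def)
  moreover have "convex hull T = convex hull (P \<union> F)"
    unfolding T_def V(2) using WF by (metis hull_Un_left hull_Un_right)
  moreover have "convex hull (V \<union> W) = convex hull (P \<union> R)"
    unfolding V(2) W(2) by (metis hull_Un_left hull_Un_right)
  ultimately show ?thesis by simp
qed

section \<open>Facets and vertices of the join\<close>

lemma facet_of_join_not_containing:
  fixes P R :: "'a::euclidean_space set"
  assumes skew: "skew A B" "P \<subseteq> A" "R \<subseteq> B" and poly: "polytope P" "polytope R"
    and dim: "aff_dim P \<ge> 1" and G: "G facet_of convex hull (P \<union> R)" and nsub: "\<not> P \<subseteq> G"
  shows "(G \<inter> P) facet_of P" "G = convex hull ((G \<inter> P) \<union> R)"
proof -
  let ?Q = "convex hull (P \<union> R)"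
  have conv: "convex P" "convex R" using poly polytope_imp_convex by auto
  have PQ: "P \<subseteq> ?Q" "R \<subseteq> ?Q" using hull_subset[of "P \<union> R" convex] by auto
  have Gface: "G face_of ?Q" and Gdim: "aff_dim G = aff_dim ?Q - 1"
    using G unfolding facet_of_def by auto
  have "compact (P \<union> R)" using poly polytope_imp_compact by auto
  then obtain S where S: "S \<subseteq> P \<union> R" "G = convex hull S"
    using face_of_convex_hull_subset Gface by blast
  \<comment> \<open>The generators \<open>S\<close> of \<open>G\<close> lie in \<open>G\<close> and
    in \<open>P\<close> or \<open>R\<close>, hence in one of the two traces.\<close>
  have Geq: "G = convex hull ((G \<inter> P) \<union> (G \<inter> R))"
  proof
    show "G \<subseteq> convex hull ((G \<inter> P) \<union> (G \<inter> R))"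
      using S hull_mono[of S "(G \<inter> P) \<union> (G \<inter> R)" convex] hull_subset[of S convex] by blast
    show "convex hull ((G \<inter> P) \<union> (G \<inter> R)) \<subseteq> G"
      using face_of_imp_convex[OF Gface] by (intro hull_minimal) auto
  qed
  have f: "(G \<inter> P) face_of P" "(G \<inter> R) face_of R"
    using face_of_slice[OF Gface conv(1)] face_of_slice[OF Gface conv(2)] PQ
    by (simp_all add: Int_absorb1)
  have "aff_dim G = aff_dim (G \<inter> P) + aff_dim (G \<inter> R) + 1"
    using Geq aff_dim_Un_skew[OF skew(1), of "G \<inter> P" "G \<inter> R"] skew aff_dim_convex_hull
    by (metis Int_lower2 subset_trans)
  moreover have "aff_dim ?Q = aff_dim P + aff_dim R + 1"
    using aff_dim_Un_skew[OF skew] by (simp add: aff_dim_convex_hull)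
  moreover have "aff_dim (G \<inter> P) < aff_dim P"
    using face_of_aff_dim_lt[OF conv(1) f(1)] nsub by blast
  moreover have le: "aff_dim (G \<inter> R) \<le> aff_dim R" by (simp add: aff_dim_subset)
  \<comment> \<open>The dimensions lost on \<open>P\<close> and on \<open>R\<close> add up to one,
    and \<open>P\<close> loses at least one; so \<open>P\<close> loses exactly one and
    \<open>R\<close> none.\<close>
  ultimately have dims: "aff_dim (G \<inter> P) = aff_dim P - 1" "aff_dim (G \<inter> R) = aff_dim R"
    using Gdim by linarith+
  \<comment> \<open>A facet must be nonempty: \<open>aff_dim P \<ge> 1\<close> makes the dimension
    of the trace at least zero.\<close>
  show "(G \<inter> P) facet_of P"
    using f(1) dims(1) dim unfolding facet_of_def by auto
  have "G \<inter> R = R"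
    using face_of_aff_dim_lt[OF conv(2) f(2)] dims(2) by fastforce
  then show "G = convex hull ((G \<inter> P) \<union> R)" using Geq by simp
qed

lemma facet_of_join:
  fixes P R :: "'a::euclidean_space set"
  assumes skew: "skew A B" "P \<subseteq> A" "R \<subseteq> B" and poly: "polytope P" "polytope R" and F: "F facet_of R"
  shows "convex hull (P \<union> F) facet_of convex hull (P \<union> R)"
proof -
  have F': "F face_of R" "F \<noteq> {}" "aff_dim F = aff_dim R - 1" using F unfolding facet_of_def by auto
  have "F \<subseteq> B" using face_of_imp_subset[OF F'(1)] skew(3) by blast
  then show ?thesis
    unfolding facet_of_def
    using convex_hull_Un_face[OF skew poly F'(1)] F' aff_dim_Un_skew[OF skew(1,2), of F] aff_dim_Un_skew[OF skew]
    by (auto simp: aff_dim_convex_hull)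
qed

lemma extreme_point_of_join:
  fixes P R :: "'a::euclidean_space set"
  assumes skew: "skew A B" "P \<subseteq> A" "R \<subseteq> B" and poly: "polytope P" "polytope R" and v: "v extreme_point_of P"
  shows "v extreme_point_of convex hull (P \<union> R)"
proof -
  \<comment> \<open>Joining \<open>P\<close> with the empty face of \<open>R\<close> exhibits
    \<open>P\<close> itself as a face of the join.\<close>
  have "convex hull (P \<union> {}) face_of convex hull (P \<union> R)"
    by (rule convex_hull_Un_face[OF skew poly]) simp
  then have "P face_of convex hull (P \<union> R)"
    using poly by (simp add: polytope_imp_convex hull_same)
  then show ?thesis using v face_of_trans by (metis face_of_singleton)
qed

section \<open>Counting matched vertices and facets\<close>

lemma extreme_points_matched_card_le:
  fixes P R :: "'a::euclidean_space set"
  assumes skew: "skew A B" "P \<subseteq> A" "R \<subseteq> B" and poly: "polytope P" "polytope R" and dim: "aff_dim P \<ge> 1"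
    and M: "vertex_facet_assignment (convex hull (P \<union> R)) M"
    and all: "\<And>v. v extreme_point_of convex hull (P \<union> R) \<Longrightarrow> \<exists>F. (v, F) \<in> M"
  shows "card {v. v extreme_point_of P} \<le> card {F. F facet_of P}"
proof -
  let ?Q = "convex hull (P \<union> R)"
  have "\<forall>v. \<exists>G. v extreme_point_of P \<longrightarrow> (v, G) \<in> M"
    using all extreme_point_of_join[OF skew poly] by blast
  then obtain g where g: "\<And>v. v extreme_point_of P \<Longrightarrow> (v, g v) \<in> M" by metis
  \<comment> \<open>The vertex \<open>v\<close> lies in \<open>P\<close> but not in its assigned
    facet, so that facet cannot contain \<open>P\<close>.\<close>
  have g': "g v facet_of ?Q" "\<not> P \<subseteq> g v" if "v extreme_point_of P" for v
    using g[OF that] M that unfolding vertex_facet_assignment_def extreme_point_of_def by auto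
  note G = facet_of_join_not_containing[OF skew poly dim g']
  show ?thesis
  proof (rule card_inj_on_le)
    show "(\<lambda>v. g v \<inter> P) ` {v. v extreme_point_of P} \<subseteq> {F. F facet_of P}"
      using G(1) by blast
    show "finite {F. F facet_of P}" using poly finite_polytope_facets by blast
    show "inj_on (\<lambda>v. g v \<inter> P) {v. v extreme_point_of P}"
    proof (rule inj_onI, simp)
      fix v w assume vw: "v extreme_point_of P" "w extreme_point_of P" "g v \<inter> P = g w \<inter> P"
      \<comment> \<open>Each of these facets is the hull of \<open>R\<close> and its trace on
        \<open>P\<close>, so equal traces force equal facets.\<close>
      then have "g v = g w" using G(2) by metis
      then show "v = w"
        using g[OF vw(1)] g[OF vw(2)] M unfolding vertex_facet_assignment_def by metis
    qed
  qed
qed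

lemma facets_matched_card_le:
  fixes P R :: "'a::euclidean_space set"
  assumes skew: "skew A B" "P \<subseteq> A" "R \<subseteq> B" and poly: "polytope P" "polytope R"
    and M: "vertex_facet_assignment (convex hull (P \<union> R)) M"
    and all: "\<And>F. F facet_of convex hull (P \<union> R) \<Longrightarrow> \<exists>v. (v, F) \<in> M"
  shows "card {F. F facet_of R} \<le> card {v. v extreme_point_of R}"
proof -
  let ?Q = "convex hull (P \<union> R)" and ?J = "\<lambda>F. convex hull (P \<union> F)"
  have "\<forall>F. \<exists>v. F facet_of R \<longrightarrow> (v, ?J F) \<in> M"
    using all facet_of_join[OF skew poly] by blast
  then obtain g where g: "\<And>F. F facet_of R \<Longrightarrow> (g F, ?J F) \<in> M" by metis
  have ext: "g F extreme_point_of R" if "F facet_of R" for F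
  proof -
    have v: "g F extreme_point_of ?Q" "g F \<notin> ?J F"
      using g[OF that] M unfolding vertex_facet_assignment_def by auto
    \<comment> \<open>An extreme point of the join lies in \<open>P\<close> or \<open>R\<close>, and
      all of \<open>P\<close> is contained in \<open>?J F\<close>.\<close>
    then have "g F \<in> R"
      using extreme_point_of_convex_hull hull_subset[of "P \<union> F" convex] by blast
    moreover have "R \<subseteq> ?Q" using hull_subset[of "P \<union> R" convex] by blast
    ultimately show ?thesis using v(1) unfolding extreme_point_of_def by blast
  qed
  show ?thesis
  proof (rule card_inj_on_le)
    show "g ` {F. F facet_of R} \<subseteq> {v. v extreme_point_of R}" using ext by blast
    show "finite {v. v extreme_point_of R}"
      using poly(2) finite_polyhedron_extreme_points polytope_imp_polyhedron by blast
    show "inj_on g {F. F facet_of R}"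
    proof (rule inj_onI, simp)
      fix F F' assume F: "F facet_of R" "F' facet_of R" "g F = g F'"
      then have "?J F = ?J F'"
        using g[OF F(1)] g[OF F(2)] M unfolding vertex_facet_assignment_def by metis
      then show "F = F'"
        using convex_hull_Un_face_Int[OF skew polytope_imp_convex[OF poly(2)]] F(1,2)
        by (metis facet_of_imp_face_of)
    qed
  qed
qed

section \<open>Invariance under affine copies\<close>

lemma affine_copy_aff_dim:
  assumes "affine_copy P P'" shows "aff_dim P' = aff_dim P"
proof -
  obtain L c where L: "linear L" "inj L" and P': "P' = (+) c ` L ` P"
    using assms unfolding affine_copy_def by (auto simp: image_image)
  show ?thesis unfolding P' using L by (simp add: aff_dim_translation_eq aff_dim_injective_linear_image)
qed

lemma affine_copy_polytope:
  assumes "affine_copy P P'" "polytope P" shows "polytope P'"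
proof -
  obtain L c where L: "linear L" "inj L" and P': "P' = (+) c ` L ` P"
    using assms unfolding affine_copy_def by (auto simp: image_image)
  show ?thesis unfolding P' using L assms by (simp add: polytope_translation_eq polytope_linear_image)
qed

text \<open>Vertices are the singleton faces and facets the nonempty faces of codimension one, so a
  single injective map carrying faces to faces transfers both counts. That each image is again an
  affine copy keeps the dimensions of faces.\<close>

lemma affine_copy_faces:
  assumes "affine_copy P P'"
  obtains f where "inj f" "\<And>F. affine_copy F (f ` F)" "{F'. F' face_of P'} = image f ` {F. F face_of P}"
proof -
  obtain L c where L: "linear L" "inj L" and P': "P' = (+) c ` L ` P"
    using assms unfolding affine_copy_def by (auto simp: image_image)
  have "{F'. F' face_of P'} = image (\<lambda>x. c + L x) ` {F. F face_of P}"
    unfolding P' faces_of_translation faces_of_linear_image[OF L] by (simp only: image_image)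
  moreover have "inj (\<lambda>x. c + L x)" using L by (simp add: inj_def)
  moreover have "affine_copy F ((\<lambda>x. c + L x) ` F)" for F
    using L unfolding affine_copy_def by blast
  ultimately show thesis using that by blast
qed

lemma affine_copy_card_extreme_points:
  assumes "affine_copy P P'"
  shows "card {v. v extreme_point_of P'} = card {v. v extreme_point_of P}"
proof -
  obtain f where f: "inj f" "{F'. F' face_of P'} = image f ` {F. F face_of P}"
    using affine_copy_faces[OF assms] by metis
  have "{v. v extreme_point_of P'} = f ` {v. v extreme_point_of P}"
  proof (intro set_eqI iffI)
    fix v assume "v \<in> {v. v extreme_point_of P'}"
    then have "{v} \<in> image f ` {F. F face_of P}"
      using f(2) by (metis face_of_singleton mem_Collect_eq)
    then obtain F where F: "F face_of P" "{v} = f ` F" by blast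
    then obtain w where "w \<in> F" "f w = v" by blast
    then have "F = {w}" using F(2) f(1) by (auto simp: inj_def)
    then show "v \<in> f ` {v. v extreme_point_of P}"
      using F(1) \<open>f w = v\<close> by (auto simp: face_of_singleton)
  next
    fix v assume "v \<in> f ` {v. v extreme_point_of P}"
    then obtain w where "{w} face_of P" "v = f w" by (auto simp: face_of_singleton)
    then have "{v} \<in> image f ` {F. F face_of P}" by force
    then show "v \<in> {v. v extreme_point_of P'}"
      using f(2) by (metis face_of_singleton mem_Collect_eq)
  qed
  then show ?thesis using f(1) by (simp add: card_image inj_on_subset)
qed

lemma affine_copy_card_facets:
  assumes "affine_copy P P'"
  shows "card {F. F facet_of P'} = card {F. F facet_of P}"
proof -
  obtain f where f: "inj f" "\<And>F. affine_copy F (f ` F)"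
    "{F'. F' face_of P'} = image f ` {F. F face_of P}"
    using affine_copy_faces[OF assms] by metis
  have "{F. F facet_of P'} = {F \<in> {F. F face_of P'}. F \<noteq> {} \<and> aff_dim F = aff_dim P - 1}"
    using affine_copy_aff_dim[OF assms] by (auto simp: facet_of_def)
  also have "\<dots> = image f ` {F. F facet_of P}"
    unfolding f(3) using affine_copy_aff_dim[OF f(2)] by (auto simp: facet_of_def)
  finally show ?thesis
    using f(1) by (simp add: card_image inj_on_def inj_image_eq_iff)
qed

theorem theorem5p2:
  fixes P1 :: "'a::euclidean_space set" and P2 :: "'b::euclidean_space set"
    and Q :: "'c::euclidean_space set"
  assumes "polytope P1" and "aff_dim P1 = int (DIM('a))"
    and "polytope P2" and "aff_dim P2 = int (DIM('b))"
    and "card {v. v extreme_point_of P1} > card {F. F facet_of P1}"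
    and "card {v. v extreme_point_of P2} < card {F. F facet_of P2}"
    and "is_free_join P1 P2 Q"
  shows "\<not> (\<exists>M. vertex_facet_assignment Q M)"
proof
  assume "\<exists>M. vertex_facet_assignment Q M"
  then obtain M where M: "vertex_facet_assignment Q M" by blast
  obtain A1 A2 P1' P2' where skew: "skew A1 A2" "P1' \<subseteq> A1" "P2' \<subseteq> A2"
    and copy: "affine_copy P1 P1'" "affine_copy P2 P2'" and Q: "Q = convex hull (P1' \<union> P2')"
    using assms(7) unfolding is_free_join_def by blast
  have poly: "polytope P1'" "polytope P2'"
    using copy assms(1,3) affine_copy_polytope by auto
  \<comment> \<open>Euclidean space types have positive dimension, so the full-dimensional
    \<open>P1\<close> is not a single point.\<close>
  have dim: "aff_dim P1' \<ge> 1"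
    using affine_copy_aff_dim[OF copy(1)] assms(2) DIM_positive[where 'a='a] by linarith
  consider "\<And>v. v extreme_point_of Q \<Longrightarrow> \<exists>F. (v, F) \<in> M" | "\<And>F. F facet_of Q \<Longrightarrow> \<exists>v. (v, F) \<in> M"
    using M unfolding vertex_facet_assignment_def by blast
  then show False
  proof cases
    case 1
    then have "card {v. v extreme_point_of P1'} \<le> card {F. F facet_of P1'}"
      using extreme_points_matched_card_le[OF skew poly dim] M unfolding Q by blast
    then show False
      using assms(5) affine_copy_card_extreme_points[OF copy(1)] affine_copy_card_facets[OF copy(1)] by simp
  next
    case 2
    then have "card {F. F facet_of P2'} \<le> card {v. v extreme_point_of P2'}"
      using facets_matched_card_le[OF skew poly] M unfolding Q by blast
    then show False
      using assms(6) affine_copy_card_extreme_points[OF copy(2)] affine_copy_card_facets[OF copy(2)] by simp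
  qed
qed

end
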